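(* Let $G=(V,E)$ be a finite simple connected graph with $n$ vertices and sink $s\in V$. Let $\mathcal{G}$ be its sandpile group (set of recurrent configurations) and $\mathcal{H}$ its set of multiplicative harmonic functions. For $h\in\mathcal{H}$ define $f_h:\mathcal{G}\to\{z\in\mathbb{C}:|z|=1\}$ by $$f_h(\eta)=\prod_{v\in V\setminus\{s\}}h(v)^{\eta(v)}.$$ Then $\{f_h\}_{h\in\mathcal{H}}$ is an orthonormal basis (with respect to $(f,g)=\frac1{|\mathcal{G}|}\sum_{\eta\in\mathcal{G}}f(\eta)\overline{g(\eta)}$ on $\mathbb{C}^{\mathcal{G}}$) of eigenfunctions for the transition matrix of the discrete time sandpile chain on $G$, and the eigenvalue associated with $f_h$ is $$\lambda_h=\frac1n\sum_{v\in V}h(v).$$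
   Context: A configuration is $\eta:V\setminus\{s\}\to\mathbb{N}$. It is stable if $\eta(v)<\deg(v)$ for all $v\ne s$. A vertex $v\neq s$ with $\eta(v)\ge\deg(v)$ may topple, losing $\deg(v)$ chips and giving one to each neighbor (chips sent to $s$ vanish). Toppling unstable vertices until none remain gives a stable configuration $\eta^\circ$ independent of the order. Put $\eta\oplus\sigma=(\eta+\sigma)^\circ$ on stable configurations. With $\eta_*(v)=\deg(v)-1$, the set $\mathcal{G}$ of recurrent configurations consists of all stable configurations of the form $\eta_*\oplus\sigma$ with $\sigma$ stable; it is a finite abelian group under $\oplus$, the sandpile group. The discrete time sandpile chain on $\mathcal{G}$ moves from $\eta$ to $(\eta+\delta_v)^\circ$ with $v$ uniform in $V$ (all $n$ vertices), where $\delta_v(u)=1\{u=v\}$ and $\delta_s\equiv0$. A transition matrix $P$ acts on functions by $(Pf)(\eta)=\sum_{\sigma}P(\eta,\sigma)f(\sigma)$. A multiplicative harmonic function is $h:V\to\{z\in\mathbb{C}:|z|=1\}$ with $h(s)=1$ and $h(v)^{\deg(v)}=\prod_{u\sim v}h(u)$ for all $v\in V$. *)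

theory Defs
  imports "HOL-Probability.Probability" "HOL-Library.Function_Algebras" "HOL-Library.FuncSet"
    "Graph_Theory.Graph_Theory"
begin

text \<open>
  Finite simple graphs are the \<open>pair_graph\<close>s of \<open>Graph_Theory\<close>: finite, loop-free digraphs without
  parallel arcs whose arc set is symmetric, so that the out-degree is the degree of the simple graph.
\<close>

abbreviation deg :: "'a pair_pre_digraph \<Rightarrow> 'a \<Rightarrow> nat" where
  "deg G v \<equiv> out_degree (with_proj G) v"

definition nbrs :: "'a pair_pre_digraph \<Rightarrow> 'a \<Rightarrow> 'a set" where
  "nbrs G v = {u. v \<rightarrow>\<^bsub>with_proj G\<^esub> u}"

text \<open>
  A function on \<open>V - {s}\<close> is represented by its extension by zero to the whole type;
  addition of configurations is then the pointwise addition of \<open>Function_Algebras\<close>.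
\<close>

definition configurations :: "'a pair_pre_digraph \<Rightarrow> 'a \<Rightarrow> ('a \<Rightarrow> nat) set" where
  "configurations G s = {\<eta>. \<forall>v. v \<notin> pverts G - {s} \<longrightarrow> \<eta> v = 0}"

definition stable_configurations :: "'a pair_pre_digraph \<Rightarrow> 'a \<Rightarrow> ('a \<Rightarrow> nat) set" where
  "stable_configurations G s =
     {\<eta> \<in> configurations G s. \<forall>v \<in> pverts G - {s}. \<eta> v < deg G v}"

definition topple_at :: "'a pair_pre_digraph \<Rightarrow> 'a \<Rightarrow> 'a \<Rightarrow> ('a \<Rightarrow> nat) \<Rightarrow> ('a \<Rightarrow> nat)" where
  "topple_at G s v \<eta> = (\<lambda>u. if u = v then \<eta> u - deg G v
                            else if u \<in> nbrs G v - {s} then \<eta> u + 1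
                            else \<eta> u)"

definition topples :: "'a pair_pre_digraph \<Rightarrow> 'a \<Rightarrow> ('a \<Rightarrow> nat) \<Rightarrow> ('a \<Rightarrow> nat) \<Rightarrow> bool" where
  "topples G s \<eta> \<eta>' \<longleftrightarrow> (\<exists>v \<in> pverts G - {s}. deg G v \<le> \<eta> v \<and> \<eta>' = topple_at G s v \<eta>)"

definition stabilize :: "'a pair_pre_digraph \<Rightarrow> 'a \<Rightarrow> ('a \<Rightarrow> nat) \<Rightarrow> ('a \<Rightarrow> nat)" where
  "stabilize G s \<eta> = (THE \<sigma>. (topples G s)\<^sup>*\<^sup>* \<eta> \<sigma> \<and> \<sigma> \<in> stable_configurations G s)"

definition sandpile_add ::
  "'a pair_pre_digraph \<Rightarrow> 'a \<Rightarrow> ('a \<Rightarrow> nat) \<Rightarrow> ('a \<Rightarrow> nat) \<Rightarrow> ('a \<Rightarrow> nat)" where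
  "sandpile_add G s \<eta> \<sigma> = stabilize G s (\<eta> + \<sigma>)"

definition max_stable :: "'a pair_pre_digraph \<Rightarrow> 'a \<Rightarrow> ('a \<Rightarrow> nat)" where
  "max_stable G s = (\<lambda>v. if v \<in> pverts G - {s} then deg G v - 1 else 0)"

definition recurrent :: "'a pair_pre_digraph \<Rightarrow> 'a \<Rightarrow> ('a \<Rightarrow> nat) set" where
  "recurrent G s = {\<eta> \<in> stable_configurations G s.
     \<exists>\<sigma> \<in> stable_configurations G s. \<eta> = sandpile_add G s (max_stable G s) \<sigma>}"

definition chip :: "'a \<Rightarrow> 'a \<Rightarrow> ('a \<Rightarrow> nat)" where
  "chip s v = (\<lambda>u. if u = v \<and> v \<noteq> s then 1 else 0)"

definition sandpile_step :: "'a pair_pre_digraph \<Rightarrow> 'a \<Rightarrow> ('a \<Rightarrow> nat) \<Rightarrow> ('a \<Rightarrow> nat) pmf" where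
  "sandpile_step G s \<eta> = map_pmf (\<lambda>v. stabilize G s (\<eta> + chip s v)) (pmf_of_set (pverts G))"

definition transition_matrix ::
  "'a pair_pre_digraph \<Rightarrow> 'a \<Rightarrow> ('a \<Rightarrow> nat) \<Rightarrow> ('a \<Rightarrow> nat) \<Rightarrow> real" where
  "transition_matrix G s \<eta> \<sigma> = pmf (sandpile_step G s \<eta>) \<sigma>"

text \<open>
  Harmonic functions live on \<open>V\<close> only, hence the extensional function space: distinct elements
  of the set differ at some vertex. The equation is also required at the sink.
\<close>

definition mult_harmonic :: "'a pair_pre_digraph \<Rightarrow> 'a \<Rightarrow> ('a \<Rightarrow> complex) set" where
  "mult_harmonic G s = {h \<in> pverts G \<rightarrow>\<^sub>E {z. cmod z = 1}.
     h s = 1 \<and> (\<forall>v \<in> pverts G. h v ^ deg G v = (\<Prod>u \<in> nbrs G v. h u))}"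

text \<open>
  The space of complex functions on a set \<open>S\<close>, each extended by zero outside \<open>S\<close>,
  as a subspace of the complex vector space of all functions on the type.
\<close>

global_interpretation cfun: vector_space "\<lambda>(c :: complex) (f :: 'b \<Rightarrow> complex) x. c * f x"
  by unfold_locales (auto simp: fun_eq_iff algebra_simps)

definition functions_on :: "'b set \<Rightarrow> ('b \<Rightarrow> complex) set" where
  "functions_on S = {f. \<forall>x. x \<notin> S \<longrightarrow> f x = 0}"

definition inner_on :: "'b set \<Rightarrow> ('b \<Rightarrow> complex) \<Rightarrow> ('b \<Rightarrow> complex) \<Rightarrow> complex" where
  "inner_on S f g = 1 / of_nat (card S) * (\<Sum>x \<in> S. f x * cnj (g x))"

text \<open>Orthonormality is that of the indexed family, so \<open>F\<close> is in particular injective on \<open>I\<close>.\<close>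

definition orthonormal_basis_on :: "'b set \<Rightarrow> 'i set \<Rightarrow> ('i \<Rightarrow> 'b \<Rightarrow> complex) \<Rightarrow> bool" where
  "orthonormal_basis_on S I F \<longleftrightarrow>
     (\<forall>i \<in> I. F i \<in> functions_on S) \<and>
     (\<forall>i \<in> I. \<forall>j \<in> I. inner_on S (F i) (F j) = (if i = j then 1 else 0)) \<and>
     cfun.independent (F ` I) \<and> cfun.span (F ` I) = functions_on S"

definition matrix_apply :: "'b set \<Rightarrow> ('b \<Rightarrow> 'b \<Rightarrow> real) \<Rightarrow> ('b \<Rightarrow> complex) \<Rightarrow> ('b \<Rightarrow> complex)" where
  "matrix_apply S P f = (\<lambda>x. if x \<in> S then \<Sum>y \<in> S. of_real (P x y) * f y else 0)"

definition eigenfunction_on ::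
  "'b set \<Rightarrow> ('b \<Rightarrow> 'b \<Rightarrow> real) \<Rightarrow> complex \<Rightarrow> ('b \<Rightarrow> complex) \<Rightarrow> bool" where
  "eigenfunction_on S P c f \<longleftrightarrow>
     f \<in> functions_on S \<and> f \<noteq> 0 \<and> matrix_apply S P f = (\<lambda>x. c * f x)"

definition harmonic_char ::
  "'a pair_pre_digraph \<Rightarrow> 'a \<Rightarrow> ('a \<Rightarrow> complex) \<Rightarrow> ('a \<Rightarrow> nat) \<Rightarrow> complex" where
  "harmonic_char G s h = (\<lambda>\<eta>. if \<eta> \<in> recurrent G s
                               then \<Prod>v \<in> pverts G - {s}. h v ^ \<eta> v else 0)"

end

theory Submission
  imports Defs "HOL-Library.Confluence" "HOL-Combinatorics.Cycles"
begin

text \<open>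
  Adding a chip at \<open>v\<close> and stabilizing is a bijection of the recurrent configurations, since they are
  finite in number and each one can be reached from each other one by adding chips. These bijections
  commute and have finite order, so averaging against roots of unity writes every function as a sum
  of joint eigenfunctions. Comparing the addition of \<open>deg v\<close> chips at \<open>v\<close> with the addition of one chip
  at each neighbour, which is what toppling does, shows that the joint eigenvalues of a nonzero
  joint eigenfunction form a multiplicative harmonic function \<open>h\<close>; by transitivity the
  eigenfunction is then a multiple of \<open>f\<^sub>h\<close>. Orthogonality holds because the sum of
  \<open>f\<^sub>h\<close> times the conjugate of \<open>f\<^sub>g\<close> is multiplied by \<open>h v / g v\<close> when it is reindexed by
  adding a chip at \<open>v\<close>.
\<close>

section \<open>Joint eigenfunctions of commuting bijections\<close>

lemma sum_fun_apply: "(\<Sum>i\<in>I. F i) x = (\<Sum>i\<in>I. (F i x :: complex))"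
  by (induction I rule: infinite_finite_induct) auto

text \<open>For fixed \<open>j\<close> the summands are the powers of
  \<open>w = cis (2 * pi * j / m)\<close>. If \<open>j \<noteq> 0\<close>, this is a root of unity
  other than 1, and the geometric sum vanishes.\<close>

lemma sum_power_roots_of_unity:
  assumes "j < m"
  shows "(\<Sum>k<m. cis (2 * pi * real k / real m) ^ j) = (if j = 0 then of_nat m else 0)"
proof (cases "j = 0")
  case False
  define w where "w = cis (2 * pi * real j / real m)"
  have m: "m > 0" using assms by simp
  have "w \<noteq> 1"
  proof
    assume "w = 1"
    then have "cis (2 * pi * real j / real m) = cis (2 * pi * real 0 / real m)"
      by (simp add: w_def)
    then show False
      using inj_onD[OF bij_betw_imp_inj_on[OF Complex.bij_betw_roots_unity[OF m]], of j 0]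
        assms False by simp
  qed
  moreover have "w ^ m = 1"
    using bij_betw_apply[OF Complex.bij_betw_roots_unity[OF m], of j] assms by (simp add: w_def)
  moreover have "cis (2 * pi * real k / real m) ^ j = w ^ k" for k
    by (simp add: w_def Complex.DeMoivre mult_ac)
  ultimately show ?thesis
    using False by (simp add: geometric_sum)
qed simp

text \<open>Extended by the identity outside \<open>S\<close>, the map permutes a finite set and
  therefore has finite order.\<close>

lemma bij_betw_finite_order:
  assumes "finite S" "bij_betw A S S"
  obtains m where "m > 0" "\<And>x. x \<in> S \<Longrightarrow> (A ^^ m) x = x"
proof -
  define p where "p x = (if x \<in> S then A x else x)" for x
  have "bij_betw p S S"
    using assms(2) by (rule bij_betw_cong[THEN iffD1, rotated]) (simp add: p_def)
  then have "p permutes S"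
    by (rule bij_imp_permutes) (simp add: p_def)
  then obtain m where m: "p ^^ m = id" "m > 0"
    using assms(1) permutation_is_nilpotent[of p] unfolding permutation_permutes by blast
  have "(p ^^ k) x = (A ^^ k) x \<and> (A ^^ k) x \<in> S" if "x \<in> S" for k x
    using that bij_betw_apply[OF assms(2)] by (induction k) (auto simp: p_def)
  then show ?thesis
    using that m by (metis id_apply)
qed

text \<open>Discrete Fourier analysis along the orbits of \<open>A\<close>: summand \<open>k\<close>
  is the component of \<open>f\<close> on which composition with \<open>A\<close> acts as the scalar
  \<open>c k\<close>.\<close>

lemma eigenfunction_decomposition:
  fixes f :: "'b \<Rightarrow> complex"
  assumes "finite S" "bij_betw A S S" "f \<in> functions_on S"
  obtains m :: nat and a c
  where "f = (\<Sum>k<m. (\<lambda>x. if x \<in> S then \<Sum>j<m. a k j * f ((A ^^ j) x) else 0))"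
    and "\<And>k x. x \<in> S \<Longrightarrow>
      (\<Sum>j<m. a k j * f ((A ^^ j) (A x))) = c k * (\<Sum>j<m. a k j * f ((A ^^ j) x))"
proof -
  obtain m where m: "m > 0" "\<And>x. x \<in> S \<Longrightarrow> (A ^^ m) x = x"
    using bij_betw_finite_order[OF assms(1,2)] by blast
  define \<zeta> where "\<zeta> k = cis (2 * pi * real k / real m)" for k
  \<comment> \<open>Averaging against the powers of \<open>\<zeta> k\<close> projects onto the
    eigenspace with eigenvalue \<open>inverse (\<zeta> k)\<close>.\<close>
  define a where "a k j = \<zeta> k ^ j / of_nat m" for k j
  have \<zeta>_pow: "\<zeta> k ^ m = 1" for k
  proof -
    have "real m * (2 * pi * real k / real m) = 2 * pi * real k"
      using m(1) by simp
    then show ?thesis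
      unfolding \<zeta>_def Complex.DeMoivre by (simp only: cis_multiple_2pi Ints_of_nat)
  qed
  have f_eq: "f x = (\<Sum>k<m. if x \<in> S then \<Sum>j<m. a k j * f ((A ^^ j) x) else 0)" for x
  proof (cases "x \<in> S")
    case True
    \<comment> \<open>Fourier inversion: after exchanging the sums, only \<open>j = 0\<close>
      survives.\<close>
    have "(\<Sum>k<m. \<Sum>j<m. a k j * f ((A ^^ j) x)) = (\<Sum>j<m. (\<Sum>k<m. \<zeta> k ^ j) / of_nat m * f ((A ^^ j) x))"
      by (subst sum.swap) (simp add: a_def sum_distrib_right sum_divide_distrib)
    also have "\<dots> = (\<Sum>j<m. if j = 0 then f x else 0)"
      using m(1) by (intro sum.cong refl) (simp add: \<zeta>_def sum_power_roots_of_unity)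
    also have "\<dots> = f x"
      using m(1) by simp
    finally show ?thesis using True by simp
  qed (use assms(3) in \<open>simp add: functions_on_def\<close>)
  have f_sum: "f = (\<Sum>k<m. (\<lambda>x. if x \<in> S then \<Sum>j<m. a k j * f ((A ^^ j) x) else 0))"
    unfolding fun_eq_iff sum_fun_apply by (intro allI f_eq)
  have shift: "(\<Sum>j<m. a k j * f ((A ^^ j) (A x))) = inverse (\<zeta> k) * (\<Sum>j<m. a k j * f ((A ^^ j) x))"
    if x: "x \<in> S" for k x
  proof -
    define t where "t j = a k j * f ((A ^^ j) x)" for j
    have "\<zeta> k * (\<Sum>j<m. a k j * f ((A ^^ j) (A x))) = (\<Sum>j<m. t (Suc j))"
      by (simp add: t_def a_def sum_distrib_left mult_ac funpow_swap1)
    also have "\<dots> = (\<Sum>j<m. t j) + t m - t 0"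
      using sum.lessThan_Suc_shift[of t m] by (simp add: algebra_simps)
    \<comment> \<open>The shifted sum closes up cyclically, because \<open>A ^^ m\<close> fixes
      \<open>x\<close> and \<open>\<zeta> k ^ m = 1\<close>.\<close>
    also have "t m = t 0"
      using x m \<zeta>_pow by (simp add: t_def a_def)
    finally have "\<zeta> k * (\<Sum>j<m. a k j * f ((A ^^ j) (A x))) = (\<Sum>j<m. t j)"
      by simp
    moreover have "\<zeta> k \<noteq> 0"
      by (simp add: \<zeta>_def)
    ultimately show ?thesis
      by (simp add: t_def field_simps)
  qed
  show ?thesis
    by (rule that[where m = m and a = a and c = "\<lambda>k. inverse (\<zeta> k)"]) (fact f_sum, erule shift)
qed

text \<open>Induction on \<open>I\<close>: splitting a joint eigenfunction by the new bijection
  \<open>A i\<close> gives eigenfunctions of \<open>A i\<close>, which keep the earlier eigenvalues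
  because \<open>A i\<close> commutes with the other maps.\<close>

lemma functions_on_span_joint_eigenfunctions:
  fixes A :: "'i \<Rightarrow> 'b \<Rightarrow> 'b"
  assumes "finite S" "finite I" and bij: "\<And>i. i \<in> I \<Longrightarrow> bij_betw (A i) S S"
    and commute: "\<And>i j x. i \<in> I \<Longrightarrow> j \<in> I \<Longrightarrow> x \<in> S \<Longrightarrow> A i (A j x) = A j (A i x)"
  shows "functions_on S \<subseteq> cfun.span {f \<in> functions_on S. \<forall>i\<in>I. \<exists>c. \<forall>x\<in>S. f (A i x) = c * f x}"
  using assms(2) bij commute
proof (induction I rule: finite_induct)
  case empty
  then show ?case by (auto intro: cfun.span_base)
next
  case (insert i I)
  let ?E = "\<lambda>I. {f \<in> functions_on S. \<forall>i\<in>I. \<exists>c. \<forall>x\<in>S. f (A i x) = c * f x}"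
  have "?E I \<subseteq> cfun.span (?E (insert i I))"
  proof
    fix f assume f: "f \<in> ?E I"
    have bij: "bij_betw (A i) S S" by (rule insert.prems) simp
    have fS: "f \<in> functions_on S" using f by simp
    obtain m a c
      where sum: "f = (\<Sum>k<m. (\<lambda>x. if x \<in> S then \<Sum>j<m. a k j * f ((A i ^^ j) x) else 0))"
      and eigen: "\<And>k x. x \<in> S \<Longrightarrow>
        (\<Sum>j<m. a k j * f ((A i ^^ j) (A i x))) = c k * (\<Sum>j<m. a k j * f ((A i ^^ j) x))"
      by (rule eigenfunction_decomposition[OF assms(1) bij fS]) (rule that)
    have in_S: "(A i ^^ j) x \<in> S" if "x \<in> S" for j x
      using that bij_betw_apply[OF bij] by (induction j) auto
    have "(\<lambda>x. if x \<in> S then \<Sum>j<m. a k j * f ((A i ^^ j) x) else 0) \<in> ?E (insert i I)"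
      (is "?F \<in> _") for k
    proof -
      have "\<exists>c. \<forall>x\<in>S. ?F (A l x) = c * ?F x" if l: "l \<in> I" for l
      proof -
        obtain d where d: "\<And>x. x \<in> S \<Longrightarrow> f (A l x) = d * f x"
          using f l by blast
        have "(A i ^^ j) (A l x) = A l ((A i ^^ j) x)" if "x \<in> S" for j x
          using insert.prems(2)[of i l] l in_S[OF that] by (induction j) simp_all
        moreover have "A l x \<in> S" if "x \<in> S" for x
          using that l bij_betw_apply[OF insert.prems(1)] by simp
        ultimately have "\<forall>x\<in>S. ?F (A l x) = d * ?F x"
          by (auto simp: d in_S sum_distrib_left mult_ac)
        then show ?thesis ..
      qed
      moreover have "\<forall>x\<in>S. ?F (A i x) = c k * ?F x"
        using eigen bij_betw_apply[OF bij] by simp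
      moreover have "?F \<in> functions_on S"
        by (simp add: functions_on_def)
      ultimately show ?thesis by blast
    qed
    then show "f \<in> cfun.span (?E (insert i I))"
      by (subst sum) (intro cfun.span_sum cfun.span_base)
  qed
  then have "cfun.span (?E I) \<subseteq> cfun.span (?E (insert i I))"
    by (intro cfun.span_minimal) auto
  moreover have "functions_on S \<subseteq> cfun.span (?E I)"
    using insert.prems by (intro insert.IH) auto
  ultimately show ?case by blast
qed

lemma subspace_functions_on: "cfun.subspace (functions_on S)"
  unfolding cfun.subspace_def by (auto simp: functions_on_def)

text \<open>Pairing a vanishing combination with its member \<open>g\<close> isolates the
  coefficient \<open>u g\<close>.\<close>

lemma orthonormal_imp_independent:
  assumes "\<And>i j. i \<in> I \<Longrightarrow> j \<in> I \<Longrightarrow> inner_on S (F i) (F j) = (if i = j then 1 else 0)"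
  shows "cfun.independent (F ` I)"
  unfolding cfun.independent_explicit_module
proof (intro allI impI)
  fix T u g
  assume T: "finite T" "T \<subseteq> F ` I" and zero: "(\<Sum>f\<in>T. (\<lambda>x. u f * f x)) = 0" and g: "g \<in> T"
  \<comment> \<open>Members of \<open>T\<close> are compared as functions, not as indices:
    \<open>F i = F j\<close> with \<open>i \<noteq> j\<close> would give an inner product equal to
    both 0 and 1.\<close>
  have orth: "inner_on S f g = (if f = g then 1 else 0)" if "f \<in> T" for f
  proof -
    obtain i j where "i \<in> I" "f = F i" "j \<in> I" "g = F j"
      using T(2) g \<open>f \<in> T\<close> by blast
    then show ?thesis
      using assms[of i j] assms[of i i] by auto
  qed
  have "(\<Sum>f\<in>T. u f * f x) = 0" for x
    using fun_cong[OF zero, of x] by (simp add: sum_fun_apply)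
  then have "0 = inner_on S (\<lambda>x. \<Sum>f\<in>T. u f * f x) g"
    by (simp add: inner_on_def)
  also have "\<dots> = (\<Sum>f\<in>T. u f * inner_on S f g)"
    unfolding inner_on_def sum_distrib_left sum_distrib_right
    by (subst sum.swap) (simp add: mult_ac)
  also have "\<dots> = (\<Sum>f\<in>T. if f = g then u f else 0)"
    by (intro sum.cong) (simp_all add: orth)
  also have "\<dots> = u g"
    using T(1) g by simp
  finally show "u g = 0" by simp
qed

section \<open>Toppling and stabilization\<close>

locale sandpile = pair_graph G for G :: "'a pair_pre_digraph" +
  fixes s :: 'a
  assumes connected: "Digraph_Component.connected (with_proj G)"
    and sink: "s \<in> pverts G"
begin

section \<open>Neighbourhoods, degrees and distance to the sink\<close>

lemma in_nbrs_iff: "u \<in> nbrs G v \<longleftrightarrow> (v, u) \<in> parcs G"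
  by (simp add: nbrs_def)

lemma nbrs_commute: "u \<in> nbrs G v \<longleftrightarrow> v \<in> nbrs G u"
  using arcs_symmetric by (auto simp: in_nbrs_iff)

lemma nbrs_subset: "nbrs G v \<subseteq> pverts G"
  by (auto simp: in_nbrs_iff dest: in_arcsD2)

lemma finite_nbrs [simp]: "finite (nbrs G v)"
  using finite_subset[OF nbrs_subset pair_finite_verts] .

lemma not_in_own_nbrs: "v \<notin> nbrs G v"
  using no_loops' by (auto simp: in_nbrs_iff)

lemma deg_eq_card_nbrs: "deg G v = card (nbrs G v)"
proof -
  have "out_arcs (with_proj G) v = Pair v ` nbrs G v"
    by (auto simp: out_arcs_def in_nbrs_iff)
  then show ?thesis
    by (simp add: out_degree_def card_image inj_on_def)
qed

lemma exists_path_to_sink: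
  assumes "v \<in> pverts G"
  shows "\<exists>k. (v, s) \<in> parcs G ^^ k"
proof -
  have "strongly_connected (with_proj G)"
    using connected symmetric_connected_imp_strongly_connected[OF pair_sym_arcs] by simp
  then have "v \<rightarrow>\<^sup>*\<^bsub>with_proj G\<^esub> s"
    using assms sink by (auto simp: strongly_connected_def)
  then have "(v, s) \<in> (parcs G)\<^sup>*"
    by (metis reachable_rtranclI with_proj_simps(3))
  then show ?thesis
    by (rule rtrancl_imp_relpow)
qed

text \<open>A strictly superharmonic weight vanishing at the sink: \<open>v\<close> at distance \<open>d\<close> from the sink gets
  \<open>N ^ D - N ^ (D - d)\<close>, where \<open>N\<close> exceeds all degrees and \<open>D\<close> all distances.\<close>

lemma exists_superharmonic_weight:
  obtains W :: "'a \<Rightarrow> nat" where "W s = 0"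
    and "\<And>v. v \<in> pverts G - {s} \<Longrightarrow> (\<Sum>u\<in>nbrs G v. W u) < deg G v * W v"
proof -
  define d where "d v = (LEAST k. (v, s) \<in> parcs G ^^ k)" for v
  define D where "D = Max (d ` pverts G)"
  define N where "N = Suc (card (pverts G))"
  define W where "W v = N ^ D - N ^ (D - d v)" for v
  have N: "N \<ge> 1" by (simp add: N_def)
  have W_add: "W v + N ^ (D - d v) = N ^ D" for v
    unfolding W_def using N by (simp add: power_increasing)
  have "d s = 0"
    unfolding d_def by (rule Least_eq_0) simp
  then have "W s = 0" by (simp add: W_def)
  moreover have "(\<Sum>u\<in>nbrs G v. W u) < deg G v * W v" if v: "v \<in> pverts G - {s}" for v
  proof -
    have "(v, s) \<in> parcs G ^^ d v"
      unfolding d_def using exists_path_to_sink v by (metis DiffD1 LeastI_ex)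
    moreover from this v obtain k where k: "d v = Suc k"
      by (cases "d v") auto
    ultimately obtain u where u: "u \<in> nbrs G v" and "(u, s) \<in> parcs G ^^ k"
      unfolding in_nbrs_iff by (metis relpow_Suc_D2)
    then have "d u \<le> k"
      unfolding d_def by (simp add: Least_le)
    moreover have "d v \<le> D"
      unfolding D_def using v by (simp add: pair_finite_verts)
    \<comment> \<open>Since \<open>d v \<le> D\<close>, the truncated subtractions are exact. The
      neighbour \<open>u\<close> nearer to the sink gains a full factor \<open>N\<close>, which
      outweighs \<open>deg G v < N\<close> copies of \<open>N ^ (D - d v)\<close>.\<close>
    ultimately have "Suc (D - d v) \<le> D - d u"
      using k by simp
    then have "N ^ Suc (D - d v) \<le> N ^ (D - d u)"
      using N by (intro power_increasing) auto
    also have "\<dots> \<le> (\<Sum>u\<in>nbrs G v. N ^ (D - d u))"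
      using u by (intro member_le_sum) auto
    finally have "N * N ^ (D - d v) \<le> (\<Sum>u\<in>nbrs G v. N ^ (D - d u))"
      by simp
    moreover have "deg G v < N"
      unfolding deg_eq_card_nbrs N_def
      using card_mono[OF pair_finite_verts nbrs_subset] by (simp add: le_imp_less_Suc)
    then have "deg G v * N ^ (D - d v) < N * N ^ (D - d v)"
      using N by simp
    moreover have "(\<Sum>u\<in>nbrs G v. W u) + (\<Sum>u\<in>nbrs G v. N ^ (D - d u)) = deg G v * N ^ D"
      by (simp add: sum.distrib[symmetric] W_add deg_eq_card_nbrs)
    moreover have "deg G v * W v + deg G v * N ^ (D - d v) = deg G v * N ^ D"
      by (metis W_add distrib_left)
    ultimately show ?thesis by linarith
  qed
  ultimately show ?thesis using that by blast
qed

text \<open>Degree 0 would put a natural number below 0 in the superharmonic inequality.\<close>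

lemma deg_pos:
  assumes "v \<in> pverts G - {s}"
  shows "0 < deg G v"
proof -
  obtain W :: "'a \<Rightarrow> nat" where "(\<Sum>u\<in>nbrs G v. W u) < deg G v * W v"
    using exists_superharmonic_weight assms by metis
  then show ?thesis by (cases "deg G v = 0") auto
qed

lemma finite_nonsink [simp]: "finite (pverts G - {s})"
  by (simp add: pair_finite_verts)

section \<open>Configurations and the finiteness of the stable ones\<close>

lemma configurationsD: "\<eta> \<in> configurations G s \<Longrightarrow> v \<notin> pverts G - {s} \<Longrightarrow> \<eta> v = 0"
  by (auto simp: configurations_def)

lemma configurations_add [intro]:
  "\<eta> \<in> configurations G s \<Longrightarrow> \<sigma> \<in> configurations G s \<Longrightarrow> \<eta> + \<sigma> \<in> configurations G s"
  by (auto simp: configurations_def)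

lemma zero_in_configurations [simp]: "0 \<in> configurations G s"
  by (auto simp: configurations_def)

lemma chip_in_configurations: "v \<in> pverts G \<Longrightarrow> chip s v \<in> configurations G s"
  by (auto simp: configurations_def chip_def)

lemma stable_imp_configuration: "\<eta> \<in> stable_configurations G s \<Longrightarrow> \<eta> \<in> configurations G s"
  by (simp add: stable_configurations_def)

lemma finite_stable_configurations: "finite (stable_configurations G s)"
proof -
  have "inj_on (\<lambda>\<eta>. restrict \<eta> (pverts G - {s})) (stable_configurations G s)"
  proof (rule inj_onI)
    fix \<eta> \<sigma> assume st: "\<eta> \<in> stable_configurations G s" "\<sigma> \<in> stable_configurations G s"
      and eq: "restrict \<eta> (pverts G - {s}) = restrict \<sigma> (pverts G - {s})"
    show "\<eta> = \<sigma>"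
    proof
      fix v show "\<eta> v = \<sigma> v"
      proof (cases "v \<in> pverts G - {s}")
        case True
        then show ?thesis using fun_cong[OF eq, of v] by (simp del: Diff_iff)
      next
        case False
        then show ?thesis using st by (metis configurationsD stable_imp_configuration)
      qed
    qed
  qed
  moreover have "restrict \<eta> (pverts G - {s}) \<in> PiE (pverts G - {s}) (\<lambda>v. {..<deg G v})"
    if "\<eta> \<in> stable_configurations G s" for \<eta>
    using that unfolding restrict_PiE_iff stable_configurations_def by simp
  moreover have "finite (PiE (pverts G - {s}) (\<lambda>v. {..<deg G v}))"
    by (intro finite_PiE) auto
  ultimately show ?thesis
    by (blast intro: inj_on_finite)
qed

section \<open>The effect of a single toppling\<close>

text \<open>Writing the loss as a gain on the other side avoids truncated subtraction. The sink is
  excluded because chips sent there vanish.\<close>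

lemma topple_at_balance:
  assumes "v \<in> pverts G - {s}" "deg G v \<le> \<eta> v" "u \<noteq> s"
  shows "topple_at G s v \<eta> u + (if u = v then deg G v else 0) = \<eta> u + (if u \<in> nbrs G v then 1 else 0)"
  using assms not_in_own_nbrs by (auto simp: topple_at_def)

text \<open>\<open>W s = 0\<close> makes the chips lost in the sink weightless, so the full
  neighbour sum may appear. For superharmonic \<open>W\<close> this measures the drop of a
  potential.\<close>

lemma topple_at_weighted_sum:
  fixes W :: "'a \<Rightarrow> nat"
  assumes v: "v \<in> pverts G - {s}" "deg G v \<le> \<eta> v" and W: "W s = 0"
  shows "(\<Sum>u\<in>pverts G - {s}. topple_at G s v \<eta> u * W u) + deg G v * W v =
    (\<Sum>u\<in>pverts G - {s}. \<eta> u * W u) + (\<Sum>u\<in>nbrs G v. W u)"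
proof -
  have "(\<Sum>u\<in>nbrs G v. W u) = (\<Sum>u\<in>(pverts G - {s}) \<inter> nbrs G v. W u)"
    using nbrs_subset W by (intro sum.mono_neutral_right) auto
  also have "\<dots> = (\<Sum>u\<in>pverts G - {s}. if u \<in> nbrs G v then W u else 0)"
    by (simp add: sum.inter_restrict)
  moreover have "deg G v * W v = (\<Sum>u\<in>pverts G - {s}. if u = v then deg G v * W u else 0)"
    using v by (simp add: pair_finite_verts)
  moreover have "topple_at G s v \<eta> u * W u + (if u = v then deg G v * W u else 0) =
      \<eta> u * W u + (if u \<in> nbrs G v then W u else 0)" if "u \<in> pverts G - {s}" for u
    using arg_cong[OF topple_at_balance[of v \<eta> u], of "\<lambda>x. x * W u"] v that
    by (auto simp: algebra_simps split: if_splits)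
  ultimately show ?thesis
    by (simp only: sum.distrib[symmetric]) (rule sum.cong; simp)
qed

text \<open>Multiplicative counterpart, with \<open>h s = 1\<close> discounting the chips lost in
  the sink. It ties toppling at \<open>v\<close> to the harmonic equation at
  \<open>v\<close>.\<close>

lemma topple_at_weighted_prod:
  fixes h :: "'a \<Rightarrow> complex"
  assumes v: "v \<in> pverts G - {s}" "deg G v \<le> \<eta> v" and h: "h s = 1"
  shows "(\<Prod>u\<in>pverts G - {s}. h u ^ topple_at G s v \<eta> u) * h v ^ deg G v =
    (\<Prod>u\<in>pverts G - {s}. h u ^ \<eta> u) * (\<Prod>u\<in>nbrs G v. h u)"
proof -
  have "(\<Prod>u\<in>nbrs G v. h u) = (\<Prod>u\<in>(pverts G - {s}) \<inter> nbrs G v. h u)"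
    using nbrs_subset h by (intro prod.mono_neutral_right) auto
  also have "\<dots> = (\<Prod>u\<in>pverts G - {s}. if u \<in> nbrs G v then h u else 1)"
    by (simp add: prod.inter_restrict)
  moreover have "h v ^ deg G v = (\<Prod>u\<in>pverts G - {s}. if u = v then h u ^ deg G v else 1)"
    using v by (simp add: pair_finite_verts)
  moreover have "h u ^ topple_at G s v \<eta> u * (if u = v then h u ^ deg G v else 1) =
      h u ^ \<eta> u * (if u \<in> nbrs G v then h u else 1)" if "u \<in> pverts G - {s}" for u
    using arg_cong[OF topple_at_balance[of v \<eta> u], of "\<lambda>k. h u ^ k"] v that
    by (auto simp: power_add split: if_splits)
  ultimately show ?thesis
    by (simp only: prod.distrib[symmetric]) (rule prod.cong; simp)
qed

section \<open>Termination and confluence of toppling\<close>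

text \<open>The chip count weighted by a superharmonic \<open>W\<close> strictly decreases in every
  toppling.\<close>

lemma wfp_topples: "wfP (topples G s)\<inverse>\<inverse>"
proof -
  obtain W :: "'a \<Rightarrow> nat" where W: "W s = 0"
    "\<And>v. v \<in> pverts G - {s} \<Longrightarrow> (\<Sum>u\<in>nbrs G v. W u) < deg G v * W v"
    using exists_superharmonic_weight by blast
  have "(\<Sum>u\<in>pverts G - {s}. \<eta>' u * W u) < (\<Sum>u\<in>pverts G - {s}. \<eta> u * W u)"
    if topples: "topples G s \<eta> \<eta>'" for \<eta> \<eta>'
  proof -
    obtain v where v: "v \<in> pverts G - {s}" "deg G v \<le> \<eta> v" "\<eta>' = topple_at G s v \<eta>"
      using topples by (auto simp: topples_def)
    then show ?thesis
      using topple_at_weighted_sum[of v \<eta> W] W by fastforce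
  qed
  then show ?thesis
    by (intro wfp_if_convertible_to_nat[where f = "\<lambda>\<eta>. \<Sum>u\<in>pverts G - {s}. \<eta> u * W u"]) auto
qed

text \<open>Both vertices hold a full degree of chips from the start, so no truncated subtraction
  loses anything and the changes simply add up.\<close>

lemma topple_at_commute:
  assumes "u \<noteq> v" "deg G u \<le> \<eta> u" "deg G v \<le> \<eta> v"
  shows "topple_at G s u (topple_at G s v \<eta>) = topple_at G s v (topple_at G s u \<eta>)"
  using assms by (auto simp: topple_at_def fun_eq_iff)

lemma topple_at_keeps_unstable:
  assumes "u \<noteq> v" "deg G u \<le> \<eta> u"
  shows "deg G u \<le> topple_at G s v \<eta> u"
  using assms by (auto simp: topple_at_def)

text \<open>Two distinct unstable vertices close a diamond: toppling one leaves the other unstable,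
  and the order does not matter.\<close>

lemma confluent_topples: "confluentp (topples G s)"
proof (rule strong_confluentp_imp_confluentp, rule strong_confluentpI)
  fix \<eta> \<sigma> \<tau> assume "topples G s \<eta> \<sigma>" "topples G s \<eta> \<tau>"
  then obtain u v where u: "u \<in> pverts G - {s}" "deg G u \<le> \<eta> u" "\<sigma> = topple_at G s u \<eta>"
    and v: "v \<in> pverts G - {s}" "deg G v \<le> \<eta> v" "\<tau> = topple_at G s v \<eta>"
    by (auto simp: topples_def)
  show "\<exists>\<upsilon>. (topples G s)\<^sup>*\<^sup>* \<sigma> \<upsilon> \<and> (topples G s)\<^sup>=\<^sup>= \<tau> \<upsilon>"
  proof (cases "u = v")
    case True
    then show ?thesis using u v by auto
  next
    case False
    then have "deg G v \<le> \<sigma> v" "deg G u \<le> \<tau> u"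
      using u v topple_at_keeps_unstable by auto
    then have "topples G s \<sigma> (topple_at G s v \<sigma>)" "topples G s \<tau> (topple_at G s u \<tau>)"
      unfolding topples_def using u(1) v(1) by blast+
    moreover have "topple_at G s u \<tau> = topple_at G s v \<sigma>"
      using False u v topple_at_commute by simp
    ultimately show ?thesis by auto
  qed
qed

lemma stable_imp_not_topples: "\<eta> \<in> stable_configurations G s \<Longrightarrow> \<not> topples G s \<eta> \<sigma>"
  by (auto simp: topples_def stable_configurations_def not_le[symmetric])

lemma topples_configuration:
  "topples G s \<eta> \<sigma> \<Longrightarrow> \<eta> \<in> configurations G s \<Longrightarrow> \<sigma> \<in> configurations G s"
  by (auto simp: topples_def configurations_def topple_at_def dest: subsetD[OF nbrs_subset])

lemma exists_stabilization:
  "\<eta> \<in> configurations G s \<Longrightarrow> \<exists>\<sigma>. (topples G s)\<^sup>*\<^sup>* \<eta> \<sigma> \<and> \<sigma> \<in> stable_configurations G s"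
proof (induction \<eta> rule: wfp_induct[OF wfp_topples])
  case (1 \<eta>)
  show ?case
  proof (cases "\<eta> \<in> stable_configurations G s")
    case False
    then obtain \<sigma> where \<sigma>: "topples G s \<eta> \<sigma>"
      using 1 by (auto simp: stable_configurations_def topples_def not_less)
    then show ?thesis
      using 1 topples_configuration by (metis conversep_iff converse_rtranclp_into_rtranclp)
  qed auto
qed

text \<open>Stable configurations are normal forms, so the common reduct supplied by confluence
  equals both.\<close>

lemma stabilization_unique:
  assumes "(topples G s)\<^sup>*\<^sup>* \<eta> \<sigma>" "\<sigma> \<in> stable_configurations G s"
    "(topples G s)\<^sup>*\<^sup>* \<eta> \<tau>" "\<tau> \<in> stable_configurations G s"
  shows "\<sigma> = \<tau>"
proof -
  obtain \<upsilon> where "(topples G s)\<^sup>*\<^sup>* \<sigma> \<upsilon>" "(topples G s)\<^sup>*\<^sup>* \<tau> \<upsilon>"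
    using confluentpD[OF confluent_topples assms(1,3)] by blast
  then show ?thesis
    using assms(2,4) stable_imp_not_topples by (metis converse_rtranclpE)
qed

section \<open>The stabilization map and its compatibility with addition\<close>

lemma stabilize_eqI:
  assumes "(topples G s)\<^sup>*\<^sup>* \<eta> \<sigma>" "\<sigma> \<in> stable_configurations G s"
  shows "stabilize G s \<eta> = \<sigma>"
  unfolding stabilize_def using assms stabilization_unique by blast

lemma
  assumes "\<eta> \<in> configurations G s"
  shows topples_stabilize: "(topples G s)\<^sup>*\<^sup>* \<eta> (stabilize G s \<eta>)"
    and stabilize_stable: "stabilize G s \<eta> \<in> stable_configurations G s"
  using exists_stabilization[OF assms] stabilize_eqI by auto

lemma stabilize_of_stable: "\<eta> \<in> stable_configurations G s \<Longrightarrow> stabilize G s \<eta> = \<eta>"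
  by (rule stabilize_eqI) auto

lemma stabilize_eq_if_topples:
  assumes "(topples G s)\<^sup>*\<^sup>* \<eta> \<sigma>" "\<eta> \<in> configurations G s"
  shows "stabilize G s \<eta> = stabilize G s \<sigma>"
proof -
  have "\<sigma> \<in> configurations G s"
    using assms by induction (auto intro: topples_configuration)
  then show ?thesis
    using assms topples_stabilize stabilize_stable stabilize_eqI by (meson rtranclp_trans)
qed

text \<open>Extra chips never disable a toppling; this is what allows stabilization in
  stages.\<close>

lemma topples_add: "topples G s \<eta> \<sigma> \<Longrightarrow> topples G s (\<eta> + \<tau>) (\<sigma> + \<tau>)"
proof -
  assume "topples G s \<eta> \<sigma>"
  then obtain v where v: "v \<in> pverts G - {s}" "deg G v \<le> \<eta> v" "\<sigma> = topple_at G s v \<eta>"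
    by (auto simp: topples_def)
  moreover from this have "\<sigma> + \<tau> = topple_at G s v (\<eta> + \<tau>)"
    by (auto simp: topple_at_def fun_eq_iff)
  ultimately show "topples G s (\<eta> + \<tau>) (\<sigma> + \<tau>)"
    unfolding topples_def by (metis plus_fun_apply trans_le_add1)
qed

lemma rtranclp_topples_add: "(topples G s)\<^sup>*\<^sup>* \<eta> \<sigma> \<Longrightarrow> (topples G s)\<^sup>*\<^sup>* (\<eta> + \<tau>) (\<sigma> + \<tau>)"
  by (induction rule: rtranclp_induct)
    (blast intro: topples_add rtranclp.rtrancl_into_rtrancl)+

lemma stabilize_add_left:
  assumes "\<eta> \<in> configurations G s" "\<tau> \<in> configurations G s"
  shows "stabilize G s (stabilize G s \<eta> + \<tau>) = stabilize G s (\<eta> + \<tau>)"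
  using assms stabilize_eq_if_topples[OF rtranclp_topples_add[OF topples_stabilize]]
    configurations_add by metis

lemma stabilize_add_right:
  assumes "\<eta> \<in> configurations G s" "\<tau> \<in> configurations G s"
  shows "stabilize G s (\<tau> + stabilize G s \<eta>) = stabilize G s (\<tau> + \<eta>)"
  using stabilize_add_left[OF assms] by (simp add: add.commute)

section \<open>Recurrent configurations\<close>

text \<open>The move of the chain for a chosen vertex \<open>v\<close>. For \<open>v = s\<close> the
  chip is zero, so stable configurations stay fixed.\<close>

definition add_chip :: "'a \<Rightarrow> ('a \<Rightarrow> nat) \<Rightarrow> ('a \<Rightarrow> nat)" where
  "add_chip v \<eta> = stabilize G s (\<eta> + chip s v)"

lemma recurrent_imp_stable: "\<eta> \<in> recurrent G s \<Longrightarrow> \<eta> \<in> stable_configurations G s"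
  by (simp add: recurrent_def)

lemma recurrent_imp_configuration: "\<eta> \<in> recurrent G s \<Longrightarrow> \<eta> \<in> configurations G s"
  by (simp add: recurrent_imp_stable stable_imp_configuration)

lemma finite_recurrent [simp]: "finite (recurrent G s)"
  by (rule finite_subset[OF _ finite_stable_configurations]) (auto simp: recurrent_imp_stable)

lemma max_stable_stable: "max_stable G s \<in> stable_configurations G s"
  using deg_pos by (auto simp: max_stable_def stable_configurations_def configurations_def)

lemma max_stable_configuration: "max_stable G s \<in> configurations G s"
  by (simp add: max_stable_stable stable_imp_configuration)

text \<open>Stabilizing \<open>\<sigma>\<close> beforehand does not change the result, which extends
  the description from stable to arbitrary \<open>\<sigma>\<close> and makes closure under adding
  chips immediate.\<close>

lemma recurrent_iff:
  "\<eta> \<in> recurrent G s \<longleftrightarrow> (\<exists>\<sigma>\<in>configurations G s. \<eta> = stabilize G s (max_stable G s + \<sigma>))"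
proof
  assume "\<eta> \<in> recurrent G s"
  then show "\<exists>\<sigma>\<in>configurations G s. \<eta> = stabilize G s (max_stable G s + \<sigma>)"
    unfolding recurrent_def sandpile_add_def using stable_imp_configuration by blast
next
  assume "\<exists>\<sigma>\<in>configurations G s. \<eta> = stabilize G s (max_stable G s + \<sigma>)"
  then obtain \<sigma> where \<sigma>: "\<sigma> \<in> configurations G s" "\<eta> = stabilize G s (max_stable G s + \<sigma>)"
    by blast
  then have "\<eta> = sandpile_add G s (max_stable G s) (stabilize G s \<sigma>)"
    by (simp add: sandpile_add_def stabilize_add_right max_stable_configuration)
  moreover have "\<eta> \<in> stable_configurations G s"
    unfolding \<sigma>(2) by (intro stabilize_stable configurations_add max_stable_configuration \<sigma>(1))
  ultimately show "\<eta> \<in> recurrent G s"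
    using stabilize_stable[OF \<sigma>(1)] unfolding recurrent_def by blast
qed

lemma max_stable_recurrent: "max_stable G s \<in> recurrent G s"
  unfolding recurrent_iff
  by (rule bexI[of _ 0]) (simp_all only: add_0_right stabilize_of_stable max_stable_stable
      zero_in_configurations)

lemma stabilize_add_assoc:
  assumes "\<eta> \<in> configurations G s" "\<sigma> \<in> configurations G s" "\<tau> \<in> configurations G s"
  shows "stabilize G s (stabilize G s (\<eta> + \<sigma>) + \<tau>) = stabilize G s (\<eta> + (\<sigma> + \<tau>))"
  by (simp only: stabilize_add_left configurations_add assms add.assoc)

lemma recurrent_add:
  assumes "\<eta> \<in> recurrent G s" "\<tau> \<in> configurations G s"
  shows "stabilize G s (\<eta> + \<tau>) \<in> recurrent G s"
proof -
  obtain \<sigma> where "\<sigma> \<in> configurations G s" "\<eta> = stabilize G s (max_stable G s + \<sigma>)"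
    using assms(1) unfolding recurrent_iff by blast
  then show ?thesis
    unfolding recurrent_iff
    using stabilize_add_assoc[OF max_stable_configuration] assms(2) configurations_add by blast
qed

text \<open>First fill \<open>\<eta>\<close> up to the maximal stable configuration, from which \<open>\<xi>\<close> is reachable by definition.\<close>

lemma recurrent_transitive:
  assumes "\<eta> \<in> recurrent G s" "\<xi> \<in> recurrent G s"
  obtains \<tau> where "\<tau> \<in> configurations G s" "\<xi> = stabilize G s (\<eta> + \<tau>)"
proof -
  obtain \<sigma> where \<sigma>: "\<sigma> \<in> configurations G s" "\<xi> = stabilize G s (max_stable G s + \<sigma>)"
    using assms(2) unfolding recurrent_iff by blast
  define \<rho> where "\<rho> v = max_stable G s v - \<eta> v" for v
  have "\<eta> v \<le> max_stable G s v" for v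
  proof (cases "v \<in> pverts G - {s}")
    case True
    then have "\<eta> v < deg G v"
      using recurrent_imp_stable[OF assms(1)] by (simp add: stable_configurations_def)
    then show ?thesis
      using True by (simp add: max_stable_def)
  next
    case False
    then show ?thesis
      using configurationsD[OF recurrent_imp_configuration[OF assms(1)]] by simp
  qed
  then have "max_stable G s = \<eta> + \<rho>"
    by (auto simp: fun_eq_iff \<rho>_def)
  moreover have "\<rho> \<in> configurations G s"
    by (auto simp: \<rho>_def configurations_def max_stable_def)
  ultimately show ?thesis
    using that[of "\<rho> + \<sigma>"] \<sigma> by (metis add.assoc configurations_add)
qed

lemma add_chip_recurrent: "\<eta> \<in> recurrent G s \<Longrightarrow> v \<in> pverts G \<Longrightarrow> add_chip v \<eta> \<in> recurrent G s"
  unfolding add_chip_def by (intro recurrent_add chip_in_configurations)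

lemma add_chip_stabilize:
  assumes "\<eta> \<in> configurations G s" "v \<in> pverts G"
  shows "add_chip v (stabilize G s \<eta>) = stabilize G s (\<eta> + chip s v)"
  unfolding add_chip_def by (intro stabilize_add_left chip_in_configurations assms)

text \<open>Both orders amount to stabilizing \<open>\<eta>\<close> with the two chips added at
  once.\<close>

lemma add_chip_commute:
  assumes "\<eta> \<in> recurrent G s" "u \<in> pverts G" "v \<in> pverts G"
  shows "add_chip u (add_chip v \<eta>) = add_chip v (add_chip u \<eta>)"
proof -
  have "add_chip u (add_chip v \<eta>) = stabilize G s (\<eta> + chip s v + chip s u)"
    if "u \<in> pverts G" "v \<in> pverts G" for u v
    unfolding add_chip_def[of v]
    using assms(1) that by (intro add_chip_stabilize configurations_add chip_in_configurations)
      (auto dest: recurrent_imp_configuration)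
  then show ?thesis
    using assms by (simp add: add.assoc add.commute[of "chip s u"])
qed

text \<open>By transitivity some \<open>\<tau>\<close> leads from \<open>add_chip v \<xi>\<close>
  back to \<open>\<xi>\<close>. Adding \<open>\<tau>\<close> first and the chip last exhibits a
  preimage of \<open>\<xi>\<close>; finiteness turns surjectivity into injectivity.\<close>

lemma add_chip_bij:
  assumes "v \<in> pverts G"
  shows "bij_betw (add_chip v) (recurrent G s) (recurrent G s)"
proof -
  have "\<xi> \<in> add_chip v ` recurrent G s" if \<xi>: "\<xi> \<in> recurrent G s" for \<xi>
  proof -
    obtain \<tau> where \<tau>: "\<tau> \<in> configurations G s" "\<xi> = stabilize G s (add_chip v \<xi> + \<tau>)"
      using recurrent_transitive[OF add_chip_recurrent[OF \<xi> assms] \<xi>] .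
    note conf = recurrent_imp_configuration[OF \<xi>] chip_in_configurations[OF assms] \<tau>(1)
    have "\<xi> = stabilize G s (\<xi> + (chip s v + \<tau>))"
      using \<tau>(2) stabilize_add_assoc[OF conf] by (simp only: add_chip_def)
    also have "\<dots> = add_chip v (stabilize G s (\<xi> + \<tau>))"
      using stabilize_add_assoc[OF conf(1,3,2)] by (simp only: add_chip_def add.commute[of \<tau>])
    finally show ?thesis
      using recurrent_add[OF \<xi> \<tau>(1)] by blast
  qed
  then have "add_chip v ` recurrent G s = recurrent G s"
    using add_chip_recurrent[OF _ assms] by blast
  then show ?thesis
    by (simp add: bij_betw_def finite_surj_inj[of "recurrent G s"])
qed

section \<open>Harmonic characters\<close>

text \<open>The formula for \<open>harmonic_char\<close>, extended to all configurations.\<close>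

definition chip_char :: "('a \<Rightarrow> complex) \<Rightarrow> ('a \<Rightarrow> nat) \<Rightarrow> complex" where
  "chip_char h \<eta> = (\<Prod>v\<in>pverts G - {s}. h v ^ \<eta> v)"

lemma harmonic_char_eq: "\<eta> \<in> recurrent G s \<Longrightarrow> harmonic_char G s h \<eta> = chip_char h \<eta>"
  by (simp add: harmonic_char_def chip_char_def)

lemma chip_char_add: "chip_char h (\<eta> + \<sigma>) = chip_char h \<eta> * chip_char h \<sigma>"
  by (simp add: chip_char_def power_add prod.distrib)

lemma chip_char_chip:
  assumes "v \<in> pverts G" "h s = 1"
  shows "chip_char h (chip s v) = h v"
proof (cases "v = s")
  case False
  have "chip_char h (chip s v) = (\<Prod>u\<in>pverts G - {s}. if u = v then h u else 1)"
    unfolding chip_char_def using False by (intro prod.cong) (auto simp: chip_def)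
  then show ?thesis
    using False assms by (simp add: pair_finite_verts)
qed (simp add: chip_char_def chip_def assms)

lemma mult_harmonicD:
  assumes "h \<in> mult_harmonic G s"
  shows "h s = 1" and "v \<in> pverts G \<Longrightarrow> cmod (h v) = 1"
    and "v \<in> pverts G \<Longrightarrow> h v ^ deg G v = (\<Prod>u\<in>nbrs G v. h u)"
  using assms by (auto simp: mult_harmonic_def)

lemma norm_chip_char:
  "h \<in> mult_harmonic G s \<Longrightarrow> cmod (chip_char h \<eta>) = 1"
  unfolding chip_char_def prod_norm[symmetric] norm_power
  by (rule prod.neutral) (simp add: mult_harmonicD)

text \<open>The harmonic equation at \<open>v\<close> says that toppling \<open>v\<close> preserves
  the product, so it is constant along a toppling sequence.\<close>

lemma chip_char_stabilize:
  assumes h: "h \<in> mult_harmonic G s" and \<eta>: "\<eta> \<in> configurations G s"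
  shows "chip_char h (stabilize G s \<eta>) = chip_char h \<eta>"
  using topples_stabilize[OF \<eta>]
proof (induction rule: rtranclp_induct)
  case (step \<sigma> \<tau>)
  then obtain v where v: "v \<in> pverts G - {s}" "deg G v \<le> \<sigma> v" "\<tau> = topple_at G s v \<sigma>"
    by (auto simp: topples_def)
  then have "chip_char h \<tau> * h v ^ deg G v = chip_char h \<sigma> * h v ^ deg G v"
    using topple_at_weighted_prod[of v \<sigma> h] mult_harmonicD[OF h] by (simp add: chip_char_def)
  moreover have "h v \<noteq> 0"
    using mult_harmonicD(2)[OF h, of v] v by auto
  ultimately show ?case
    using step.IH by simp
qed simp

lemma chip_char_add_chip:
  assumes "h \<in> mult_harmonic G s" "\<eta> \<in> recurrent G s" "v \<in> pverts G"
  shows "chip_char h (add_chip v \<eta>) = h v * chip_char h \<eta>"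
  unfolding add_chip_def using assms
  by (simp add: chip_char_stabilize chip_char_add chip_char_chip mult_harmonicD
      recurrent_imp_configuration chip_in_configurations configurations_add mult.commute)

section \<open>Orthonormality\<close>

lemma sum_chip_char_eq_0:
  assumes h: "h \<in> mult_harmonic G s" and g: "g \<in> mult_harmonic G s" and "h \<noteq> g"
  shows "(\<Sum>\<eta>\<in>recurrent G s. chip_char h \<eta> * cnj (chip_char g \<eta>)) = 0" (is "?T = 0")
proof -
  \<comment> \<open>Both functions are extensional, so being distinct means differing at some vertex
    of the graph.\<close>
  have "h \<in> extensional (pverts G)" "g \<in> extensional (pverts G)"
    using h g by (auto simp: mult_harmonic_def PiE_def)
  then obtain v where v: "v \<in> pverts G" "h v \<noteq> g v"
    using \<open>h \<noteq> g\<close> by (metis extensionalityI)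
  have "?T = (\<Sum>\<eta>\<in>recurrent G s. chip_char h (add_chip v \<eta>) * cnj (chip_char g (add_chip v \<eta>)))"
    using sum.reindex_bij_betw[OF add_chip_bij[OF v(1)]] by (rule sym)
  also have "\<dots> = h v * cnj (g v) * ?T"
    unfolding sum_distrib_left using v h g
    by (intro sum.cong) (simp_all add: chip_char_add_chip mult_ac)
  finally have "?T = h v * cnj (g v) * ?T" .
  moreover have "g v * cnj (g v) = 1"
    using mult_harmonicD(2)[OF g v(1)] by (simp add: complex_norm_square[symmetric])
  \<comment> \<open>As \<open>cnj (g v)\<close> inverts \<open>g v\<close>, a product equal to 1
    would force \<open>h v = g v\<close>.\<close>
  then have "h v * cnj (g v) \<noteq> 1"
    using v(2) by (metis mult.commute mult.left_commute mult.right_neutral)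
  ultimately show ?thesis by auto
qed

lemma inner_on_harmonic_char:
  assumes h: "h \<in> mult_harmonic G s" and g: "g \<in> mult_harmonic G s"
  shows "inner_on (recurrent G s) (harmonic_char G s h) (harmonic_char G s g) = (if h = g then 1 else 0)"
proof -
  have "inner_on (recurrent G s) (harmonic_char G s h) (harmonic_char G s g) =
      1 / of_nat (card (recurrent G s)) * (\<Sum>\<eta>\<in>recurrent G s. chip_char h \<eta> * cnj (chip_char g \<eta>))"
    by (simp add: inner_on_def harmonic_char_eq)
  moreover have "chip_char h \<eta> * cnj (chip_char h \<eta>) = 1" for \<eta>
    using norm_chip_char[OF h, of \<eta>] by (simp add: complex_norm_square[symmetric])
  \<comment> \<open>The maximal stable configuration ensures that the normalizing factor is not a
    division by zero.\<close>
  moreover have "card (recurrent G s) \<noteq> 0"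
    using max_stable_recurrent by auto
  ultimately show ?thesis
    using sum_chip_char_eq_0[OF assms] by auto
qed

section \<open>Joint eigenfunctions are multiples of harmonic characters\<close>

text \<open>Induction on the number of chips in \<open>\<sigma>\<close>, removing one at a time.
  About \<open>h\<close> it assumes just the eigenvalue relations and \<open>h s = 1\<close>, so it
  can serve to prove that \<open>h\<close> is harmonic.\<close>

lemma joint_eigenfunction_stabilize:
  assumes eigen: "\<And>v \<eta>. v \<in> pverts G - {s} \<Longrightarrow> \<eta> \<in> recurrent G s \<Longrightarrow> f (add_chip v \<eta>) = h v * f \<eta>"
    and \<eta>: "\<eta> \<in> recurrent G s" and h: "h s = 1"
  shows "\<sigma> \<in> configurations G s \<Longrightarrow> f (stabilize G s (\<eta> + \<sigma>)) = chip_char h \<sigma> * f \<eta>"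
proof (induction "\<Sum>v\<in>pverts G - {s}. \<sigma> v" arbitrary: \<sigma>)
  case 0
  then have "\<sigma> = 0"
    by (auto simp: configurations_def fun_eq_iff pair_finite_verts)
  then show ?case
    using \<eta> by (simp only: add_0_right stabilize_of_stable recurrent_imp_stable)
      (simp add: chip_char_def)
next
  case (Suc n)
  then obtain v where v: "v \<in> pverts G - {s}" "\<sigma> v \<noteq> 0"
    by (metis nat.distinct(1) sum.neutral)
  define \<rho> where "\<rho> = \<sigma>(v := \<sigma> v - 1)"
  have \<sigma>: "\<sigma> = \<rho> + chip s v"
    using v by (auto simp: \<rho>_def chip_def fun_eq_iff)
  have \<rho>: "\<rho> \<in> configurations G s"
    using Suc.prems by (auto simp: \<rho>_def configurations_def)
  have "(\<Sum>u\<in>pverts G - {s}. chip s v u) = (\<Sum>u\<in>pverts G - {s}. if u = v then 1 else 0)"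
    using v by (intro sum.cong) (auto simp: chip_def)
  then have "(\<Sum>u\<in>pverts G - {s}. \<sigma> u) = Suc (\<Sum>u\<in>pverts G - {s}. \<rho> u)"
    using v by (simp add: \<sigma> sum.distrib pair_finite_verts)
  then have IH: "f (stabilize G s (\<eta> + \<rho>)) = chip_char h \<rho> * f \<eta>"
    using Suc.hyps \<rho> by simp
  have "f (stabilize G s (\<eta> + \<sigma>)) = f (add_chip v (stabilize G s (\<eta> + \<rho>)))"
    unfolding \<sigma> add_chip_def
    using stabilize_add_assoc[OF recurrent_imp_configuration[OF \<eta>] \<rho>] v chip_in_configurations
    by simp
  also have "\<dots> = h v * (chip_char h \<rho> * f \<eta>)"
    using eigen[OF v(1) recurrent_add[OF \<eta> \<rho>]] IH by simp
  also have "h v = chip_char h (chip s v)"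
    using v h by (simp add: chip_char_chip)
  finally show ?case
    unfolding \<sigma> chip_char_add by (simp only: mult_ac)
qed

text \<open>The equations away from the sink imply the one at the sink, because every edge contributes
  equally to the products of the two sides over all vertices.\<close>

lemma harmonic_at_sink:
  fixes h :: "'a \<Rightarrow> complex"
  assumes eq: "\<And>v. v \<in> pverts G - {s} \<Longrightarrow> h v ^ deg G v = (\<Prod>u\<in>nbrs G v. h u)"
    and nz: "\<And>v. v \<in> pverts G \<Longrightarrow> h v \<noteq> 0"
  shows "h s ^ deg G s = (\<Prod>u\<in>nbrs G s. h u)"
proof -
  have "(\<Prod>v\<in>pverts G. \<Prod>u\<in>nbrs G v. h u) = (\<Prod>v\<in>pverts G. \<Prod>u | u \<in> pverts G \<and> u \<in> nbrs G v. h u)"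
    using nbrs_subset by (intro prod.cong) auto
  also have "\<dots> = (\<Prod>u\<in>pverts G. \<Prod>v | v \<in> pverts G \<and> u \<in> nbrs G v. h u)"
    by (rule prod.swap_restrict) (simp_all add: pair_finite_verts)
  also have "\<dots> = (\<Prod>u\<in>pverts G. h u ^ deg G u)"
  proof (rule prod.cong)
    fix u
    have "{v. v \<in> pverts G \<and> u \<in> nbrs G v} = nbrs G u"
      using nbrs_subset nbrs_commute by blast
    then show "(\<Prod>v | v \<in> pverts G \<and> u \<in> nbrs G v. h u) = h u ^ deg G u"
      by (simp add: deg_eq_card_nbrs)
  qed simp
  finally have "(\<Prod>v\<in>pverts G. h v ^ deg G v) = (\<Prod>v\<in>pverts G. \<Prod>u\<in>nbrs G v. h u)" ..
  moreover have "(\<Prod>v\<in>pverts G - {s}. \<Prod>u\<in>nbrs G v. h u) = (\<Prod>v\<in>pverts G - {s}. h v ^ deg G v)"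
    by (intro prod.cong refl eq[symmetric])
  \<comment> \<open>Splitting off the sink leaves a common nonzero factor, which can be
    cancelled.\<close>
  ultimately have "h s ^ deg G s * (\<Prod>v\<in>pverts G - {s}. h v ^ deg G v) =
      (\<Prod>u\<in>nbrs G s. h u) * (\<Prod>v\<in>pverts G - {s}. h v ^ deg G v)"
    by (simp only: prod.remove[OF pair_finite_verts sink])
  moreover have "(\<Prod>v\<in>pverts G - {s}. h v ^ deg G v) \<noteq> 0"
    using nz by (simp add: pair_finite_verts)
  ultimately show ?thesis
    by (simp only: mult_cancel_right) simp
qed

text \<open>The finite order of \<open>add_chip v\<close> makes \<open>h v\<close> a root of unity.
  The equation at \<open>v\<close> holds because adding a configuration before or after a toppling
  scales \<open>f \<eta> \<noteq> 0\<close> by the same factor.\<close>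

lemma joint_eigenfunction_harmonic:
  assumes eigen: "\<And>v \<eta>. v \<in> pverts G - {s} \<Longrightarrow> \<eta> \<in> recurrent G s \<Longrightarrow> f (add_chip v \<eta>) = h v * f \<eta>"
    and \<eta>: "\<eta> \<in> recurrent G s" "f \<eta> \<noteq> 0"
    and h: "h s = 1" "h \<in> extensional (pverts G)"
  shows "h \<in> mult_harmonic G s"
proof -
  have norm: "cmod (h v) = 1" if v: "v \<in> pverts G" for v
  proof (cases "v = s")
    case False
    obtain m where m: "m > 0" "\<And>\<eta>. \<eta> \<in> recurrent G s \<Longrightarrow> (add_chip v ^^ m) \<eta> = \<eta>"
      using bij_betw_finite_order[OF finite_recurrent add_chip_bij[OF v]] by blast
    have "f ((add_chip v ^^ k) \<eta>) = h v ^ k * f \<eta> \<and> (add_chip v ^^ k) \<eta> \<in> recurrent G s" for k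
      using False v \<eta>(1) by (induction k) (simp_all add: eigen add_chip_recurrent)
    then have "h v ^ m = 1"
      using m \<eta> by (metis mult_cancel_right2)
    then show ?thesis
      using m(1) power_eq_1_iff by blast
  qed (simp add: h)
  have eq: "h v ^ deg G v = (\<Prod>u\<in>nbrs G v. h u)" if v: "v \<in> pverts G - {s}" for v
  proof -
    \<comment> \<open>Just enough chips for \<open>v\<close> to topple once.\<close>
    define \<sigma> where "\<sigma> = (\<lambda>u. if u = v then deg G v else 0)"
    have \<sigma>: "\<sigma> \<in> configurations G s"
      using v by (auto simp: \<sigma>_def configurations_def)
    have char: "chip_char h \<sigma> = h v ^ deg G v"
    proof -
      have "chip_char h \<sigma> = (\<Prod>u\<in>pverts G - {s}. if u = v then h u ^ deg G u else 1)"
        unfolding chip_char_def by (intro prod.cong) (auto simp: \<sigma>_def)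
      then show ?thesis using v by (simp add: pair_finite_verts)
    qed
    have topples: "topples G s \<sigma> (topple_at G s v \<sigma>)"
      using v by (auto simp: topples_def \<sigma>_def)
    then have "stabilize G s (\<sigma> + \<eta>) = stabilize G s (topple_at G s v \<sigma> + \<eta>)"
      using \<sigma> recurrent_imp_configuration[OF \<eta>(1)]
      by (intro stabilize_eq_if_topples r_into_rtranclp topples_add configurations_add)
    moreover have "f (stabilize G s (\<tau> + \<eta>)) = chip_char h \<tau> * f \<eta>" if "\<tau> \<in> configurations G s" for \<tau>
      using joint_eigenfunction_stabilize[of f h, OF eigen \<eta>(1) h(1) that]
      by (simp only: add.commute[of \<tau>])
    ultimately have "chip_char h \<sigma> * f \<eta> = chip_char h (topple_at G s v \<sigma>) * f \<eta>"
      using \<sigma> topples_configuration[OF topples \<sigma>] by metis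
    then have "chip_char h (topple_at G s v \<sigma>) = chip_char h \<sigma>"
      using \<eta>(2) by simp
    \<comment> \<open>Toppling has been shown to preserve the product, so its balance becomes the
      harmonic equation times a nonzero factor.\<close>
    then have "chip_char h \<sigma> * h v ^ deg G v = chip_char h \<sigma> * (\<Prod>u\<in>nbrs G v. h u)"
      using topple_at_weighted_prod[of v \<sigma> h] v h(1) by (simp add: chip_char_def \<sigma>_def)
    moreover have "chip_char h \<sigma> \<noteq> 0"
      using norm[of v] v by (auto simp: char)
    ultimately show ?thesis by simp
  qed
  have "h s ^ deg G s = (\<Prod>u\<in>nbrs G s. h u)"
    using eq norm by (intro harmonic_at_sink) fastforce+
  then have "h v ^ deg G v = (\<Prod>u\<in>nbrs G v. h u)" if "v \<in> pverts G" for v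
    using eq that by (cases "v = s") auto
  then show ?thesis
    using norm h by (simp add: mult_harmonic_def PiE_def)
qed

text \<open>Joint eigenfunctions span, so one of them, \<open>f\<close>, may be treated alone. Its
  eigenvalues give \<open>h\<close>, and transitivity from a point where \<open>f\<close> does not
  vanish determines \<open>f\<close> up to a constant.\<close>

lemma functions_on_recurrent_span:
  "functions_on (recurrent G s) \<subseteq> cfun.span (harmonic_char G s ` mult_harmonic G s)"
proof -
  let ?R = "recurrent G s"
  let ?E = "{f \<in> functions_on ?R. \<forall>v\<in>pverts G. \<exists>c. \<forall>\<eta>\<in>?R. f (add_chip v \<eta>) = c * f \<eta>}"
  have "f \<in> cfun.span (harmonic_char G s ` mult_harmonic G s)" if f: "f \<in> ?E" for f
  proof (cases "f = 0")
    case True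
    then show ?thesis by (simp only: cfun.span_zero)
  next
    case False
    then obtain \<eta> where \<eta>: "\<eta> \<in> ?R" "f \<eta> \<noteq> 0"
      using f by (auto simp: functions_on_def fun_eq_iff)
    obtain c where c: "\<And>v \<eta>. v \<in> pverts G \<Longrightarrow> \<eta> \<in> ?R \<Longrightarrow> f (add_chip v \<eta>) = c v * f \<eta>"
      using f by (simp add: Ball_def) metis
    \<comment> \<open>The sink gets the prescribed value 1, and \<open>undefined\<close> off the
      graph makes \<open>h\<close> extensional.\<close>
    define h where "h = (\<lambda>v. if v = s then 1 else if v \<in> pverts G then c v else undefined)"
    have eigen: "f (add_chip v \<eta>) = h v * f \<eta>" if "v \<in> pverts G - {s}" "\<eta> \<in> ?R" for v \<eta>
      using that c by (simp add: h_def)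
    have "h s = 1" "h \<in> extensional (pverts G)"
      using sink by (auto simp: h_def extensional_def)
    then have h: "h \<in> mult_harmonic G s"
      using joint_eigenfunction_harmonic[OF eigen \<eta>] by blast
    have nz: "chip_char h \<eta> \<noteq> 0"
      using norm_chip_char[OF h, of \<eta>] by auto
    \<comment> \<open>The constant is found by comparing both sides at
      \<open>\<eta>\<close>.\<close>
    have "f \<xi> = f \<eta> / chip_char h \<eta> * harmonic_char G s h \<xi>" for \<xi>
    proof (cases "\<xi> \<in> ?R")
      case True
      then obtain \<tau> where \<tau>: "\<tau> \<in> configurations G s" "\<xi> = stabilize G s (\<eta> + \<tau>)"
        using recurrent_transitive[OF \<eta>(1)] by blast
      have "f \<xi> = chip_char h \<tau> * f \<eta>"
        unfolding \<tau>(2) using \<open>h s = 1\<close> \<eta>(1) \<tau>(1)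
        by (intro joint_eigenfunction_stabilize eigen)
      moreover have "harmonic_char G s h \<xi> = chip_char h \<eta> * chip_char h \<tau>"
        using h True \<tau> recurrent_imp_configuration[OF \<eta>(1)]
        by (simp add: harmonic_char_eq chip_char_stabilize configurations_add chip_char_add)
      ultimately show ?thesis
        using nz by simp
    next
      case False
      then show ?thesis
        using f by (simp add: functions_on_def harmonic_char_def)
    qed
    then have "f = (\<lambda>\<xi>. f \<eta> / chip_char h \<eta> * harmonic_char G s h \<xi>)"
      by blast
    also have "\<dots> \<in> cfun.span (harmonic_char G s ` mult_harmonic G s)"
      using h by (intro cfun.span_scale cfun.span_base) blast
    finally show ?thesis .
  qed
  then have "cfun.span ?E \<subseteq> cfun.span (harmonic_char G s ` mult_harmonic G s)"
    by (intro cfun.span_minimal) auto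
  moreover have "functions_on ?R \<subseteq> cfun.span ?E"
    by (rule functions_on_span_joint_eigenfunctions)
      (simp_all add: pair_finite_verts add_chip_bij add_chip_commute)
  ultimately show ?thesis by blast
qed

section \<open>The transition matrix and its eigenvalues\<close>

text \<open>A step from a recurrent configuration stays recurrent, so the row sum is the full
  expectation of \<open>f\<close> after one step; this is pulled back to the uniform choice of
  \<open>v\<close>.\<close>

lemma matrix_apply_transition_matrix:
  "matrix_apply (recurrent G s) (transition_matrix G s) f =
    (\<lambda>\<eta>. if \<eta> \<in> recurrent G s then (\<Sum>v\<in>pverts G. f (add_chip v \<eta>)) / of_nat (card (pverts G)) else 0)"
proof
  fix \<eta>
  have V: "finite (pverts G)" "pverts G \<noteq> {}"
    using sink pair_finite_verts by auto
  show "matrix_apply (recurrent G s) (transition_matrix G s) f \<eta> =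
    (if \<eta> \<in> recurrent G s then (\<Sum>v\<in>pverts G. f (add_chip v \<eta>)) / of_nat (card (pverts G)) else 0)"
  proof (cases "\<eta> \<in> recurrent G s")
    case True
    have "(\<Sum>\<sigma>\<in>recurrent G s. of_real (transition_matrix G s \<eta> \<sigma>) * f \<sigma>)
        = (\<Sum>\<sigma>\<in>recurrent G s. pmf (sandpile_step G s \<eta>) \<sigma> *\<^sub>R f \<sigma>)"
      by (simp add: transition_matrix_def scaleR_conv_of_real)
    also have "\<dots> = measure_pmf.expectation (sandpile_step G s \<eta>) f"
      using True add_chip_recurrent V
      by (intro integral_measure_pmf[symmetric]) (auto simp: sandpile_step_def add_chip_def)
    also have "\<dots> = (\<Sum>v\<in>pverts G. f (add_chip v \<eta>)) / of_nat (card (pverts G))"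
      unfolding sandpile_step_def add_chip_def integral_map_pmf using V
      by (subst integral_measure_pmf[of "pverts G"])
        (simp_all add: scaleR_conv_of_real sum_divide_distrib)
    finally show ?thesis
      using True by (simp add: matrix_apply_def)
  qed (simp add: matrix_apply_def)
qed

text \<open>A chip at \<open>v\<close> multiplies the character by \<open>h v\<close>, and averaging
  over \<open>v\<close> gives the eigenvalue. Modulus 1 at the maximal stable configuration shows
  that the function is nonzero.\<close>

lemma harmonic_char_eigenfunction:
  assumes h: "h \<in> mult_harmonic G s"
  shows "eigenfunction_on (recurrent G s) (transition_matrix G s)
    (1 / of_nat (card (pverts G)) * (\<Sum>v\<in>pverts G. h v)) (harmonic_char G s h)"
proof -
  have "harmonic_char G s h (max_stable G s) \<noteq> 0"
    using norm_chip_char[OF h, of "max_stable G s"] max_stable_recurrent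
    by (auto simp: harmonic_char_eq)
  then have "harmonic_char G s h \<noteq> 0" by auto
  moreover have "(\<Sum>v\<in>pverts G. harmonic_char G s h (add_chip v \<eta>)) =
      (\<Sum>v\<in>pverts G. h v) * harmonic_char G s h \<eta>" if "\<eta> \<in> recurrent G s" for \<eta>
    using that h by (simp add: harmonic_char_eq add_chip_recurrent chip_char_add_chip sum_distrib_right)
  then have "matrix_apply (recurrent G s) (transition_matrix G s) (harmonic_char G s h) =
      (\<lambda>\<eta>. 1 / of_nat (card (pverts G)) * (\<Sum>v\<in>pverts G. h v) * harmonic_char G s h \<eta>)"
    unfolding matrix_apply_transition_matrix
    by (intro ext) (simp add: harmonic_char_def)
  ultimately show ?thesis
    by (simp add: eigenfunction_on_def functions_on_def harmonic_char_def)
qed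

lemma harmonic_char_basis:
  "orthonormal_basis_on (recurrent G s) (mult_harmonic G s) (harmonic_char G s)"
proof -
  have "harmonic_char G s ` mult_harmonic G s \<subseteq> functions_on (recurrent G s)"
    by (auto simp: harmonic_char_def functions_on_def)
  moreover from this have "cfun.span (harmonic_char G s ` mult_harmonic G s) = functions_on (recurrent G s)"
    using functions_on_recurrent_span
    by (intro subset_antisym cfun.span_minimal subspace_functions_on)
  moreover have "cfun.independent (harmonic_char G s ` mult_harmonic G s)"
    by (rule orthonormal_imp_independent) (rule inner_on_harmonic_char)
  ultimately show ?thesis
    unfolding orthonormal_basis_on_def by (simp add: inner_on_harmonic_char image_subset_iff)
qed

end

theorem theorem2p6:
  fixes G :: "'a pair_pre_digraph" and s :: 'a and n :: nat
  assumes "pair_graph G"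
    and "Digraph_Component.connected (with_proj G)"
    and "n = card (pverts G)"
    and "s \<in> pverts G"
  shows "(\<forall>h \<in> mult_harmonic G s. \<forall>\<eta> \<in> recurrent G s. cmod (harmonic_char G s h \<eta>) = 1)
    \<and> orthonormal_basis_on (recurrent G s) (mult_harmonic G s) (harmonic_char G s)
    \<and> (\<forall>h \<in> mult_harmonic G s.
         eigenfunction_on (recurrent G s) (transition_matrix G s)
           (1 / of_nat n * (\<Sum>v \<in> pverts G. h v)) (harmonic_char G s h))"
proof -
  interpret pair_graph G by fact
  interpret sandpile G s
    by unfold_locales (fact assms)+
  show ?thesis
    using harmonic_char_basis harmonic_char_eigenfunction
    by (simp add: harmonic_char_eq norm_chip_char assms(3))
qed

end
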